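(* Let $W$ be a weight matrix of size $N$. The map $$\Lambda:\mathcal D(W)\longrightarrow\operatorname{Mat}_N(\mathbb C[n]),\qquad D\mapsto\Lambda(D),$$ is an injective homomorphism of algebras; in particular $\Lambda(D_1D_2)=\Lambda(D_1)\Lambda(D_2)$ for all $D_1,D_2\in\mathcal D(W)$.
   Context: A weight matrix $W$ of size $N$ on an interval $(x_0,x_1)$ is a smooth function $W:(x_0,x_1)\to\operatorname{Mat}_N(\mathbb C)$, positive definite almost everywhere, with finite moments of all orders. Standing assumption: for each integer $n\ge0$ the derivative $W^{(n)}(x)$ decreases exponentially at infinity and there is a scalar polynomial $p_n(x)$ such that $W^{(n)}(x)p_n(x)$ has finite moments. The sesquilinear form is $\langle P,Q\rangle_W=\int_{x_0}^{x_1}P(x)W(x)Q(x)^*dx$ on $\operatorname{Mat}_N(\mathbb C[x])$. There is a unique sequence of monic matrix polynomials $P_n$ ($\deg P_n=n$, leading coefficient $I$) with $\langle P_n,P_m\rangle_W=0$ for $n\ne m$. $\operatorname{Mat}_N(\Omega[x])$ is the algebra of matrix differential operators $D=\sum_{j=0}^m\partial^jF_j(x)$, $F_j\in\operatorname{Mat}_N(\mathbb C[x])$, acting on the right: $P\cdot D=\sum_j \partial^j(P)(x)F_j(x)$; products satisfy $P\cdot(D_1D_2)=(P\cdot D_1)\cdot D_2$. $\mathcal D(W)=\{D\in\operatorname{Mat}_N(\Omega[x]): \text{for all } n\ge0,\ P_n\cdot D=\Lambda_n(D)P_n\text{ for some }\Lambda_n(D)\in\operatorname{Mat}_N(\mathbb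 C)\}$. Every $D=\sum_{i=0}^m\partial^iF_i(x)\in\mathcal D(W)$ satisfies $\deg F_i\le i$; writing $F_i(x)=\sum_{j=0}^ix^jF^i_j$ with $F^i_j\in\operatorname{Mat}_N(\mathbb C)$, the eigenvalue for the monic sequence is $\Lambda_n(D)=\sum_{i=0}^m[n]_iF^i_i$, where $[n]_i=n(n-1)\cdots(n-i+1)$ and $[n]_0=1$. $\Lambda(D)$ denotes the matrix polynomial function $n\mapsto\Lambda_n(D)$, an element of $\operatorname{Mat}_N(\mathbb C[n])$, the algebra of $N\times N$ matrices with entries polynomials in the variable $n$. *)

theory Defs
  imports "HOL-Analysis.Analysis" "HOL-Library.Landau_Symbols"
begin

section \<open>Matrices and matrix polynomials\<close>

definition mat_scale :: "'a::times \<Rightarrow> 'a^'n^'m \<Rightarrow> 'a^'n^'m" where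
  "mat_scale c A = (\<chi> i j. c * A $ i $ j)"

definition conj_transpose :: "complex^'n^'n \<Rightarrow> complex^'n^'n" where
  "conj_transpose A = (\<chi> i j. cnj (A $ j $ i))"

definition pos_definite :: "complex^'n^'n \<Rightarrow> bool" where
  "pos_definite A \<longleftrightarrow> conj_transpose A = A \<and>
     (\<forall>v::complex^'n. v \<noteq> 0 \<longrightarrow> Re (\<Sum>i\<in>UNIV. \<Sum>j\<in>UNIV. cnj (v $ i) * A $ i $ j * v $ j) > 0)"

text \<open>Elements of the algebra of matrices over \<open>\<complex>[x]\<close> (or \<open>\<complex>[n]\<close>) are matrices of polynomials.
  Matrix products are always \<open>**\<close>; the operation \<open>*\<close> on \<open>vec\<close> is entrywise and is not used.\<close>

definition mat_poly_coeff :: "complex poly^'n^'n \<Rightarrow> nat \<Rightarrow> complex^'n^'n" where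
  "mat_poly_coeff P k = (\<chi> i j. coeff (P $ i $ j) k)"

definition mat_poly_eval :: "complex poly^'n^'n \<Rightarrow> complex \<Rightarrow> complex^'n^'n" where
  "mat_poly_eval P z = (\<chi> i j. poly (P $ i $ j) z)"

definition mat_poly_const :: "complex^'n^'n \<Rightarrow> complex poly^'n^'n" where
  "mat_poly_const A = (\<chi> i j. [:A $ i $ j:])"

definition mat_pderiv :: "complex poly^'n^'n \<Rightarrow> complex poly^'n^'n" where
  "mat_pderiv P = (\<chi> i j. pderiv (P $ i $ j))"

definition monic_of_degree :: "nat \<Rightarrow> complex poly^'n^'n \<Rightarrow> bool" where
  "monic_of_degree n P \<longleftrightarrow> mat_poly_coeff P n = mat 1 \<and> (\<forall>k>n. mat_poly_coeff P k = 0)"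


section \<open>Weight matrices\<close>

text \<open>The interval is \<open>einterval x0 x1\<close> with extended real end points; only the values of
  \<open>W\<close> on it matter.\<close>

definition nth_deriv :: "nat \<Rightarrow> (real \<Rightarrow> complex^'n^'n) \<Rightarrow> real \<Rightarrow> complex^'n^'n" where
  "nth_deriv n W = ((\<lambda>V x. vector_derivative V (at x)) ^^ n) W"

definition smooth_on_interval :: "ereal \<Rightarrow> ereal \<Rightarrow> (real \<Rightarrow> complex^'n^'n) \<Rightarrow> bool" where
  "smooth_on_interval x0 x1 W \<longleftrightarrow>
     (\<forall>n. \<forall>x\<in>einterval x0 x1. nth_deriv n W differentiable (at x))"

definition finite_moments :: "ereal \<Rightarrow> ereal \<Rightarrow> (real \<Rightarrow> complex^'n^'n) \<Rightarrow> bool" where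
  "finite_moments x0 x1 V \<longleftrightarrow>
     (\<forall>k. set_integrable lborel (einterval x0 x1) (\<lambda>x. x ^ k *\<^sub>R V x))"

text \<open>A condition only at those end points of the interval that are infinite.\<close>

definition exp_decay_at_infinity :: "ereal \<Rightarrow> ereal \<Rightarrow> (real \<Rightarrow> complex^'n^'n) \<Rightarrow> bool" where
  "exp_decay_at_infinity x0 x1 V \<longleftrightarrow>
     (x1 = \<infinity> \<longrightarrow> (\<exists>c>0. (\<lambda>x. norm (V x)) \<in> O[at_top](\<lambda>x. exp (- c * x)))) \<and>
     (x0 = -\<infinity> \<longrightarrow> (\<exists>c>0. (\<lambda>x. norm (V x)) \<in> O[at_bot](\<lambda>x. exp (c * x))))"

text \<open>The last two conjuncts are the standing assumption on the derivatives of the weight;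
  the polynomial \<open>p\<close> is required to be nonzero, as otherwise its existence would say nothing.\<close>

definition weight_matrix :: "ereal \<Rightarrow> ereal \<Rightarrow> (real \<Rightarrow> complex^'n^'n) \<Rightarrow> bool" where
  "weight_matrix x0 x1 W \<longleftrightarrow>
     x0 < x1 \<and>
     smooth_on_interval x0 x1 W \<and>
     (AE x in lborel. x \<in> einterval x0 x1 \<longrightarrow> pos_definite (W x)) \<and>
     finite_moments x0 x1 W \<and>
     (\<forall>n. exp_decay_at_infinity x0 x1 (nth_deriv n W)) \<and>
     (\<forall>n. \<exists>p::complex poly. p \<noteq> 0 \<and>
        finite_moments x0 x1 (\<lambda>x. mat_scale (poly p (of_real x)) (nth_deriv n W x)))"

definition weight_inner ::
    "ereal \<Rightarrow> ereal \<Rightarrow> (real \<Rightarrow> complex^'n^'n) \<Rightarrow> complex poly^'n^'n \<Rightarrow> complex poly^'n^'n \<Rightarrow> complex^'n^'n" where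
  "weight_inner x0 x1 W P Q =
     (LBINT x=x0..x1. mat_poly_eval P (of_real x) ** W x ** conj_transpose (mat_poly_eval Q (of_real x)))"

definition is_monic_orthogonal ::
    "ereal \<Rightarrow> ereal \<Rightarrow> (real \<Rightarrow> complex^'n^'n) \<Rightarrow> (nat \<Rightarrow> complex poly^'n^'n) \<Rightarrow> bool" where
  "is_monic_orthogonal x0 x1 W P \<longleftrightarrow>
     (\<forall>n. monic_of_degree n (P n)) \<and>
     (\<forall>n m. n \<noteq> m \<longrightarrow> weight_inner x0 x1 W (P n) (P m) = 0)"

definition monic_OP ::
    "ereal \<Rightarrow> ereal \<Rightarrow> (real \<Rightarrow> complex^'n^'n) \<Rightarrow> nat \<Rightarrow> complex poly^'n^'n" where
  "monic_OP x0 x1 W = (THE P. is_monic_orthogonal x0 x1 W P)"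


section \<open>Matrix differential operators acting on the right\<close>

text \<open>An operator \<open>D = (\<Sum>j. \<partial>^j F\<^sub>j)\<close> is its finitely supported sequence of matrix
  coefficients \<open>F\<^sub>j = diffop_coeff D j\<close>.\<close>

typedef 'n diffop = "{F :: nat \<Rightarrow> (complex poly^'n::finite^'n). finite {j. F j \<noteq> 0}}"
  morphisms diffop_coeff Abs_diffop
  by (rule exI[of _ "\<lambda>_. 0"]) simp

definition diffop_supp :: "'n::finite diffop \<Rightarrow> nat set" where
  "diffop_supp D = {j. diffop_coeff D j \<noteq> 0}"

definition diffop_act :: "complex poly^'n^'n \<Rightarrow> 'n::finite diffop \<Rightarrow> complex poly^'n^'n" (infixl "\<cdot>\<^sub>D" 70) where
  "P \<cdot>\<^sub>D D = (\<Sum>j\<in>diffop_supp D. (mat_pderiv ^^ j) P ** diffop_coeff D j)"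

definition diffop_single :: "nat \<Rightarrow> complex poly^'n^'n \<Rightarrow> 'n::finite diffop" where
  "diffop_single j F = Abs_diffop (\<lambda>k. if k = j then F else 0)"

definition diffop_scale :: "complex \<Rightarrow> 'n::finite diffop \<Rightarrow> 'n diffop" where
  "diffop_scale c D = Abs_diffop (\<lambda>k. mat_scale [:c:] (diffop_coeff D k))"

lemma diffop_coeff_Abs: "finite {j. F j \<noteq> 0} \<Longrightarrow> diffop_coeff (Abs_diffop F) = F"
  by (simp add: Abs_diffop_inverse)

lemma finite_diffop_coeff: "finite {j. diffop_coeff D j \<noteq> 0}"
  using diffop_coeff[of D] by simp

lemma diffop_eq_iff: "D = E \<longleftrightarrow> (\<forall>j. diffop_coeff D j = diffop_coeff E j)"
  by (metis diffop_coeff_inject ext)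

lemma diffop_coeff_single: "diffop_coeff (diffop_single j F) = (\<lambda>k. if k = j then F else 0)"
  unfolding diffop_single_def
  by (rule diffop_coeff_Abs, rule finite_subset[of _ "{j}"]) auto

lemma diffop_coeff_scale: "diffop_coeff (diffop_scale c D) k = mat_scale [:c:] (diffop_coeff D k)"
  unfolding diffop_scale_def
  by (subst diffop_coeff_Abs, rule finite_subset[OF _ finite_diffop_coeff[of D]])
     (auto simp: mat_scale_def vec_eq_iff)

instantiation diffop :: (finite) ab_group_add
begin

definition zero_diffop :: "'a diffop" where
  "zero_diffop = Abs_diffop (\<lambda>_. 0)"

definition plus_diffop :: "'a diffop \<Rightarrow> 'a diffop \<Rightarrow> 'a diffop" where
  "D + E = Abs_diffop (\<lambda>k. diffop_coeff D k + diffop_coeff E k)"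

definition uminus_diffop :: "'a diffop \<Rightarrow> 'a diffop" where
  "- D = Abs_diffop (\<lambda>k. - diffop_coeff D k)"

definition minus_diffop :: "'a diffop \<Rightarrow> 'a diffop \<Rightarrow> 'a diffop" where
  "D - E = Abs_diffop (\<lambda>k. diffop_coeff D k - diffop_coeff E k)"

lemma diffop_coeff_zero: "diffop_coeff (0 :: 'a diffop) k = 0"
  by (simp add: zero_diffop_def diffop_coeff_Abs)

lemma diffop_coeff_add: "diffop_coeff (D + E) k = diffop_coeff D k + diffop_coeff (E :: 'a diffop) k"
  unfolding plus_diffop_def
  by (subst diffop_coeff_Abs,
      rule finite_subset[OF _ finite_UnI[OF finite_diffop_coeff[of D] finite_diffop_coeff[of E]]]) auto

lemma diffop_coeff_uminus: "diffop_coeff (- D) k = - diffop_coeff (D :: 'a diffop) k"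
  unfolding uminus_diffop_def by (simp add: diffop_coeff_Abs finite_diffop_coeff)

lemma diffop_coeff_diff: "diffop_coeff (D - E) k = diffop_coeff D k - diffop_coeff (E :: 'a diffop) k"
  unfolding minus_diffop_def
  by (subst diffop_coeff_Abs,
      rule finite_subset[OF _ finite_UnI[OF finite_diffop_coeff[of D] finite_diffop_coeff[of E]]]) auto

instance
  by standard
     (simp_all add: diffop_eq_iff diffop_coeff_zero diffop_coeff_add diffop_coeff_uminus
       diffop_coeff_diff add.assoc add.commute)

end

lemma mat_pderiv_add: "mat_pderiv (P + Q) = mat_pderiv P + mat_pderiv Q"
  by (simp add: mat_pderiv_def vec_eq_iff pderiv_add)

lemma mat_pderiv_mult: "mat_pderiv (P ** Q) = mat_pderiv P ** Q + P ** mat_pderiv Q"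
  by (simp add: mat_pderiv_def vec_eq_iff matrix_matrix_mult_def higher_pderiv_sum[where n=1, simplified]
      pderiv_mult sum.distrib add.commute mult.commute)

lemma mat_pderiv_scale: "mat_pderiv (mat_scale (of_nat c) P) = mat_scale (of_nat c) (mat_pderiv P)"
  by (simp add: mat_pderiv_def mat_scale_def vec_eq_iff pderiv_mult)

lemma mat_pderiv_zero [simp]: "mat_pderiv 0 = 0"
  by (simp add: mat_pderiv_def vec_eq_iff)

lemma mat_pderiv_sum: "mat_pderiv (sum f A) = (\<Sum>x\<in>A. mat_pderiv (f x))"
  by (induction A rule: infinite_finite_induct) (simp_all add: mat_pderiv_add)

lemma mat_higher_pderiv_add: "(mat_pderiv ^^ k) (P + Q) = (mat_pderiv ^^ k) P + (mat_pderiv ^^ k) Q"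
  by (induction k) (simp_all add: mat_pderiv_add)

lemma mat_higher_pderiv_zero [simp]: "(mat_pderiv ^^ k) 0 = 0"
  by (induction k) simp_all

lemma mat_higher_pderiv_sum: "(mat_pderiv ^^ k) (sum f A) = (\<Sum>x\<in>A. (mat_pderiv ^^ k) (f x))"
  by (induction A rule: infinite_finite_induct) (simp_all add: mat_higher_pderiv_add)

lemma mat_add_rdistrib: "(A + B) ** (C :: complex poly^'n^'n) = A ** C + B ** C"
  by (simp add: vec_eq_iff matrix_matrix_mult_def sum.distrib distrib_right)

lemma mat_zero_mult [simp]: "0 ** (A :: complex poly^'n^'n) = 0" "(A :: complex poly^'n^'n) ** 0 = 0"
  by (simp_all add: vec_eq_iff matrix_matrix_mult_def)

lemma mat_sum_mult: "sum f S ** (A :: complex poly^'n^'n) = (\<Sum>x\<in>S. f x ** A)"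
  by (induction S rule: infinite_finite_induct) (simp_all add: mat_add_rdistrib)

lemma mat_mult_sum: "(A :: complex poly^'n^'n) ** sum f S = (\<Sum>x\<in>S. A ** f x)"
  by (induction S rule: infinite_finite_induct) (simp_all add: matrix_add_ldistrib)

lemma mat_scale_mult: "mat_scale c A ** (B :: complex poly^'n^'n) = mat_scale c (A ** B)"
  "A ** mat_scale c (B :: complex poly^'n^'n) = mat_scale c (A ** B)"
  by (simp_all add: vec_eq_iff matrix_matrix_mult_def mat_scale_def sum_distrib_left mult_ac)

lemma mat_scale_add: "mat_scale c A + mat_scale d A = mat_scale (c + d) (A :: complex poly^'n^'n)"
  by (simp add: vec_eq_iff mat_scale_def distrib_right)

lemma mat_scale_simps [simp]: "mat_scale 0 (A :: complex poly^'n^'n) = 0" "mat_scale 1 A = A"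
  by (simp_all add: vec_eq_iff mat_scale_def)

lemma mat_pderiv_mult_higher:
  "(mat_pderiv ^^ m) (P ** (Q :: complex poly^'n^'n)) =
     (\<Sum>l\<le>m. mat_scale (of_nat (m choose l)) ((mat_pderiv ^^ (m - l)) P ** (mat_pderiv ^^ l) Q))"
proof (induction m)
  case (Suc m)
  define T where "T a b = (mat_pderiv ^^ a) P ** (mat_pderiv ^^ b) Q" for a b
  have "(mat_pderiv ^^ Suc m) (P ** Q) =
      (\<Sum>l\<le>m. mat_scale (of_nat (m choose l)) (T (Suc (m - l)) l)) +
      (\<Sum>l\<le>m. mat_scale (of_nat (m choose l)) (T (m - l) (Suc l)))"
    by (simp add: Suc mat_pderiv_sum mat_pderiv_scale mat_pderiv_mult T_def sum.distrib[symmetric])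
       (simp add: mat_scale_def vec_eq_iff distrib_left)
  also have "(\<Sum>l\<le>m. mat_scale (of_nat (m choose l)) (T (Suc (m - l)) l)) =
      (\<Sum>l\<le>Suc m. mat_scale (of_nat (m choose l)) (T (Suc m - l) l))"
    by (simp add: Suc_diff_le binomial_eq_0)
  also have "\<dots> = T (Suc m) 0 + (\<Sum>l\<le>m. mat_scale (of_nat (m choose Suc l)) (T (m - l) (Suc l)))"
    by (subst sum.atMost_Suc_shift) simp
  also have "\<dots> + (\<Sum>l\<le>m. mat_scale (of_nat (m choose l)) (T (m - l) (Suc l))) =
      T (Suc m) 0 + (\<Sum>l\<le>m. mat_scale (of_nat (Suc m choose Suc l)) (T (m - l) (Suc l)))"
    by (simp add: add.assoc sum.distrib[symmetric] mat_scale_add add.commute)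
  also have "\<dots> = (\<Sum>l\<le>Suc m. mat_scale (of_nat (Suc m choose l)) (T (Suc m - l) l))"
    by (subst sum.atMost_Suc_shift) simp
  finally show ?case by (simp only: T_def)
qed simp

lemma finite_diffop_supp [simp]: "finite (diffop_supp D)"
  using diffop_coeff[of D] by (simp add: diffop_supp_def)

lemma diffop_act_superset:
  assumes "finite S" "diffop_supp D \<subseteq> S"
  shows "P \<cdot>\<^sub>D D = (\<Sum>j\<in>S. (mat_pderiv ^^ j) P ** diffop_coeff D j)"
  unfolding diffop_act_def using assms
  by (intro sum.mono_neutral_left) (auto simp: diffop_supp_def)

lemma diffop_act_add_right: "P \<cdot>\<^sub>D (D + E) = P \<cdot>\<^sub>D D + P \<cdot>\<^sub>D E"
proof -
  have "diffop_supp (D + E) \<subseteq> diffop_supp D \<union> diffop_supp E"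
    by (auto simp: diffop_supp_def diffop_coeff_add)
  then show ?thesis
    by (simp add: diffop_act_superset[where S="diffop_supp D \<union> diffop_supp E"]
        diffop_coeff_add matrix_add_ldistrib sum.distrib)
qed

lemma diffop_act_zero_right [simp]: "P \<cdot>\<^sub>D 0 = 0"
  by (simp add: diffop_act_def diffop_coeff_zero)

lemma diffop_act_sum_right: "P \<cdot>\<^sub>D (sum f A) = (\<Sum>x\<in>A. P \<cdot>\<^sub>D f x)"
  by (induction A rule: infinite_finite_induct) (simp_all add: diffop_act_add_right)

lemma diffop_act_add_left: "(P + Q) \<cdot>\<^sub>D D = P \<cdot>\<^sub>D D + Q \<cdot>\<^sub>D D"
  by (simp add: diffop_act_def mat_higher_pderiv_add mat_add_rdistrib sum.distrib)

lemma diffop_act_single: "P \<cdot>\<^sub>D diffop_single j F = (mat_pderiv ^^ j) P ** F"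
  by (subst diffop_act_superset[where S="{j}"])
     (auto simp: diffop_supp_def diffop_coeff_single)

lemma mat_pderiv_power_coeff:
  "(mat_pderiv ^^ j) (P :: complex poly^'n^'n) = (\<chi> a b. (pderiv ^^ j) (P $ a $ b))"
  by (induction j) (simp_all add: mat_pderiv_def vec_eq_iff)

text \<open>The action is faithful, so that the algebra structure below is the one for which it is a
  right action.\<close>

lemma diffop_act_inject:
  assumes "\<And>P. P \<cdot>\<^sub>D D = P \<cdot>\<^sub>D E"
  shows "D = E"
proof -
  define C where "C = D - E"
  have "D = E + C" by (simp add: C_def)
  then have act: "P \<cdot>\<^sub>D C = 0" for P
    using assms[of P] by (simp add: diffop_act_add_right)
  have "diffop_coeff C j = 0" for j
  proof (induction j rule: less_induct)
    case (less j)
    define X :: "complex poly^'a^'a" where "X = mat (monom 1 j)"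
    have "(mat_pderiv ^^ i) X ** diffop_coeff C i = 0" if "i \<noteq> j" for i
    proof (cases "i < j")
      case False
      then have "i > j" using that by simp
      then have "(pderiv ^^ i) (monom (1::complex) j) = 0"
        by (intro poly_eqI) (simp add: coeff_higher_pderiv)
      then have "(mat_pderiv ^^ i) X = 0"
        by (simp add: mat_pderiv_power_coeff X_def mat_def vec_eq_iff)
      then show ?thesis by simp
    qed (simp add: less)
    then have "X \<cdot>\<^sub>D C = (mat_pderiv ^^ j) X ** diffop_coeff C j"
      by (subst diffop_act_superset[where S="insert j (diffop_supp C)"])
         (auto simp: sum.remove[where x=j])
    also have "(mat_pderiv ^^ j) X = mat_scale (of_nat (fact j)) (mat 1)"
    proof -
      have "(pderiv ^^ j) (monom (1::complex) j) = of_nat (fact j)"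
        by (intro poly_eqI)
           (auto simp: coeff_higher_pderiv of_nat_poly pochhammer_fact[symmetric] coeff_pCons split: nat.split)
      then show ?thesis
        by (simp add: mat_pderiv_power_coeff X_def mat_def vec_eq_iff mat_scale_def del: of_nat_fact)
    qed
    finally have "mat_scale (of_nat (fact j)) (diffop_coeff C j) = 0"
      using act[of X] by (simp add: mat_scale_mult)
    then show ?case by (simp add: vec_eq_iff mat_scale_def del: of_nat_fact)
  qed
  then have "C = 0" by (simp add: diffop_eq_iff diffop_coeff_zero)
  then show ?thesis by (simp add: C_def)
qed

text \<open>The product is determined by
  \<open>(\<partial>^i F) (\<partial>^j G) = (\<Sum>l\<le>j. \<partial>^(i + j - l) (j choose l) F^(l) G)\<close>, which is the Leibniz rule
  read for operators acting on the right.\<close>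

instantiation diffop :: (finite) ring_1
begin

definition one_diffop :: "'a diffop" where
  "one_diffop = diffop_single 0 (mat 1)"

definition times_diffop :: "'a diffop \<Rightarrow> 'a diffop \<Rightarrow> 'a diffop" where
  "D * E = (\<Sum>i\<in>diffop_supp D. \<Sum>j\<in>diffop_supp E. \<Sum>l\<le>j.
     diffop_single (i + j - l)
       (mat_scale (of_nat (j choose l)) ((mat_pderiv ^^ l) (diffop_coeff D i) ** diffop_coeff E j)))"

lemma diffop_act_times: "P \<cdot>\<^sub>D (D * E) = (P \<cdot>\<^sub>D D) \<cdot>\<^sub>D (E :: 'a diffop)"
proof -
  have *: "(\<Sum>l\<le>j. (mat_pderiv ^^ (i + j - l)) P **
        mat_scale (of_nat (j choose l)) ((mat_pderiv ^^ l) F ** G)) =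
      (mat_pderiv ^^ j) ((mat_pderiv ^^ i) P ** F) ** G" for i j and F G :: "complex poly^'a^'a"
  proof -
    have "(mat_pderiv ^^ (i + j - l)) P = (mat_pderiv ^^ (j - l)) ((mat_pderiv ^^ i) P)" if "l \<le> j" for l
      using that by (simp add: funpow_add[unfolded o_def fun_eq_iff, rule_format, symmetric] add.commute)
    then show ?thesis
      by (simp add: mat_pderiv_mult_higher mat_sum_mult mat_scale_mult matrix_mul_assoc)
  qed
  show ?thesis
    by (simp add: times_diffop_def diffop_act_sum_right diffop_act_single *)
       (simp add: diffop_act_def mat_higher_pderiv_sum mat_sum_mult sum.swap[of _ _ "diffop_supp D"])
qed

instance
proof
  fix a b c :: "'a diffop"
  have one: "P \<cdot>\<^sub>D 1 = P" for P :: "complex poly^'a^'a"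
    by (simp add: one_diffop_def diffop_act_single)
  show "a * b * c = a * (b * c)"
    by (rule diffop_act_inject) (simp add: diffop_act_times)
  show "1 * a = a" "a * 1 = a"
    by (rule diffop_act_inject, simp add: diffop_act_times one)+
  show "(a + b) * c = a * c + b * c" "a * (b + c) = a * b + a * c"
    by (rule diffop_act_inject, simp add: diffop_act_times diffop_act_add_left diffop_act_add_right)+
  have "mat 1 \<noteq> (0 :: complex poly^'a^'a)"
    by (simp add: vec_eq_iff mat_def)
  then show "0 \<noteq> (1 :: 'a diffop)"
    using one[of "mat 1"] by (metis diffop_act_zero_right)
qed

end


section \<open>The algebra \<open>\<D>(W)\<close> and the eigenvalue map\<close>

definition weight_diffops :: "ereal \<Rightarrow> ereal \<Rightarrow> (real \<Rightarrow> complex^'n^'n) \<Rightarrow> 'n::finite diffop set" where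
  "weight_diffops x0 x1 W =
     {D. \<forall>n. \<exists>A. monic_OP x0 x1 W n \<cdot>\<^sub>D D = mat_poly_const A ** monic_OP x0 x1 W n}"

definition eigenvalue ::
    "ereal \<Rightarrow> ereal \<Rightarrow> (real \<Rightarrow> complex^'n^'n) \<Rightarrow> 'n::finite diffop \<Rightarrow> nat \<Rightarrow> complex^'n^'n" where
  "eigenvalue x0 x1 W D n =
     (THE A. monic_OP x0 x1 W n \<cdot>\<^sub>D D = mat_poly_const A ** monic_OP x0 x1 W n)"

text \<open>\<open>\<Lambda>(D)\<close> is the function \<open>n \<mapsto> \<Lambda>\<^sub>n(D)\<close> as an element of the algebra of matrices over
  \<open>\<complex>[n]\<close>: a matrix polynomial is determined by its values at all natural numbers.\<close>

definition Lambda ::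
    "ereal \<Rightarrow> ereal \<Rightarrow> (real \<Rightarrow> complex^'n^'n) \<Rightarrow> 'n::finite diffop \<Rightarrow> complex poly^'n^'n" where
  "Lambda x0 x1 W D = (THE L. \<forall>n. mat_poly_eval L (of_nat n) = eigenvalue x0 x1 W D n)"

definition is_subalgebra :: "'n::finite diffop set \<Rightarrow> bool" where
  "is_subalgebra S \<longleftrightarrow> 1 \<in> S \<and>
     (\<forall>D\<in>S. \<forall>E\<in>S. D + E \<in> S \<and> D * E \<in> S) \<and> (\<forall>c. \<forall>D\<in>S. diffop_scale c D \<in> S)"

definition is_algebra_hom_on :: "'n::finite diffop set \<Rightarrow> ('n diffop \<Rightarrow> complex poly^'n^'n) \<Rightarrow> bool" where
  "is_algebra_hom_on S h \<longleftrightarrow> h 1 = mat 1 \<and>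
     (\<forall>D\<in>S. \<forall>E\<in>S. h (D + E) = h D + h E \<and> h (D * E) = h D ** h E) \<and>
     (\<forall>c. \<forall>D\<in>S. h (diffop_scale c D) = mat_scale [:c:] (h D))"

end

theory Submission
  imports Defs
begin

text \<open>An operator \<open>D\<close> in \<open>\<D>(W)\<close> is governed by its eigenvalue equations
  \<open>P\<^sub>n D = \<Lambda>\<^sub>n(D) P\<^sub>n\<close>. The \<open>P\<^sub>n\<close> are monic of degree \<open>n\<close>, and this has three effects.
  The eigenvalue is unique, being the coefficient of \<open>x^n\<close> in \<open>P\<^sub>n D\<close>. Every matrix
  polynomial is a left combination of the \<open>P\<^sub>n\<close> over the constant matrices, so, since operators act
  on the right and commute with left multiplication by constants, \<open>D\<close> is determined by the
  \<open>P\<^sub>n D\<close>, hence by its eigenvalues: this is injectivity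
  (\<open>diffop_eq_on_monic_sequence\<close>). And \<open>D\<close> maps polynomials of degree below \<open>n\<close> to such
  polynomials, so that the coefficient of \<open>x^n\<close> in \<open>P\<^sub>n D\<close> equals that in \<open>x^n D\<close>,
  which can be read off from the coefficients \<open>F\<^sub>i\<close> of \<open>D\<close>: it is the sum of the
  \<open>n(n-1)\<dots>(n-i+1)\<close> times the \<open>i\<close>-th coefficient of \<open>F\<^sub>i\<close>, a polynomial in \<open>n\<close>
  (\<open>leading_eigenvalue\<close>). The homomorphism laws hold for the eigenvalues at each \<open>n\<close>, for
  example \<open>P\<^sub>n D E = \<Lambda>\<^sub>n(D) P\<^sub>n E = \<Lambda>\<^sub>n(D) \<Lambda>\<^sub>n(E) P\<^sub>n\<close>, and they pass to the
  matrix polynomials \<open>\<Lambda>(D)\<close> because a polynomial is determined by its values at the natural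
  numbers.

  What remains is that the monic orthogonal sequence exists and is unique, without which
  the description defining the \<open>P\<^sub>n\<close> would say nothing about them. This is Gram-Schmidt
  orthogonalisation (\<open>ex1_orthogonal_monic\<close>), whose one analytic input is that
  \<open>\<langle>P,P\<rangle>\<^sub>W = 0\<close> forces \<open>P = 0\<close>. That in turn holds (\<open>weight_inner_definite\<close>) because for
  a nonzero row \<open>p\<close> of \<open>P\<close> the diagonal entry of \<open>\<langle>P,P\<rangle>\<^sub>W\<close> is the integral of
  \<open>p(x) W(x) p(x)\<^sup>*\<close>, whose integrand is positive off the finitely many zeros of \<open>p\<close> and a null set.\<close>

section \<open>Coefficients of matrix polynomials\<close>

lemma mat_poly_coeff_simps [simp]:
  "mat_poly_coeff (P + Q) k = mat_poly_coeff P k + mat_poly_coeff Q k"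
  "mat_poly_coeff (P - Q) k = mat_poly_coeff P k - mat_poly_coeff Q k"
  "mat_poly_coeff 0 k = 0"
  by (simp_all add: mat_poly_coeff_def vec_eq_iff)

lemma mat_poly_coeff_sum: "mat_poly_coeff (sum f S) k = (\<Sum>x\<in>S. mat_poly_coeff (f x) k)"
  by (induction S rule: infinite_finite_induct) simp_all

lemma mat_poly_coeff_const_mult [simp]:
  "mat_poly_coeff (mat_poly_const A ** P) k = A ** mat_poly_coeff P k"
  by (simp add: mat_poly_coeff_def mat_poly_const_def vec_eq_iff matrix_matrix_mult_def coeff_sum)

lemma mat_poly_eqI: "(\<And>k. mat_poly_coeff P k = mat_poly_coeff Q k) \<Longrightarrow> P = Q"
  by (auto simp: mat_poly_coeff_def vec_eq_iff intro!: poly_eqI)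

lemma matrix_mult_rdistrib:
  fixes A B :: "'a::semiring_1^'n^'m"
  shows "(A + B) ** C = A ** C + B ** C"
  by (simp add: vec_eq_iff matrix_matrix_mult_def distrib_right sum.distrib)

lemma mat_poly_const_algebra:
  fixes P :: "complex poly^'n^'n"
  shows
  "mat_poly_const (A + B) ** P = mat_poly_const A ** P + mat_poly_const B ** P"
  "mat_poly_const (A ** B) ** P = mat_poly_const A ** (mat_poly_const B ** P)"
  "mat_poly_const (mat 1) ** P = P"
  by (rule mat_poly_eqI, simp add: matrix_mul_assoc[symmetric] matrix_mult_rdistrib)+

lemma mat_poly_const_scale:
  fixes P :: "complex poly^'n^'n"
  shows "mat_poly_const (mat_scale c A) ** P = mat_scale [:c:] (mat_poly_const A ** P)"
proof -
  have "mat_poly_coeff (mat_scale [:c:] Q) k = mat_scale c (mat_poly_coeff Q k)" for Q :: "complex poly^'n^'n" and k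
    by (simp add: mat_poly_coeff_def mat_scale_def vec_eq_iff)
  moreover have "mat_scale c A ** B = mat_scale c (A ** B)" for B :: "complex^'n^'n"
    by (simp add: mat_scale_def vec_eq_iff matrix_matrix_mult_def sum_distrib_left mult.assoc)
  ultimately show ?thesis by (intro mat_poly_eqI) simp
qed

definition degree_below :: "nat \<Rightarrow> complex poly^'n^'n \<Rightarrow> bool" where
  "degree_below n P \<longleftrightarrow> (\<forall>k\<ge>n. mat_poly_coeff P k = 0)"

lemma degree_below_exists: "\<exists>n. degree_below n P"
proof -
  let ?S = "range (\<lambda>(i, j). degree (P $ i $ j))"
  have "degree (P $ i $ j) \<le> Max ?S" for i j
    by (rule Max_ge) (auto intro: rev_image_eqI[of "(i, j)"])
  then have "coeff (P $ i $ j) k = 0" if "Suc (Max ?S) \<le> k" for i j k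
    using that by (intro coeff_eq_0) (meson Suc_le_lessD le_less_trans)
  then have "degree_below (Suc (Max ?S)) P"
    by (simp add: degree_below_def mat_poly_coeff_def vec_eq_iff)
  then show ?thesis ..
qed

lemma degree_below_monic_remainder:
  assumes "monic_of_degree n P" "degree_below (Suc n) Q"
  shows "degree_below n (Q - mat_poly_const (mat_poly_coeff Q n) ** P)"
  using assms unfolding degree_below_def monic_of_degree_def
  by (metis Suc_leI diff_self le_neq_implies_less mat_poly_coeff_const_mult mat_poly_coeff_simps(2)
      matrix_mul_rid times0_right)

text \<open>The expansion of \<open>Q\<close> in a monic sequence over the constant matrices, obtained by removing
  leading terms, cast as an induction principle.\<close>

lemma monic_sequence_induct [consumes 2, case_names zero step]:
  assumes "\<And>k. k < n \<Longrightarrow> monic_of_degree k (P k)" "degree_below n Q"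
    and zero: "S 0"
    and step: "\<And>k A R. k < n \<Longrightarrow> S R \<Longrightarrow> S (mat_poly_const A ** P k + R)"
  shows "S Q"
  using assms(1,2) step
proof (induction n arbitrary: Q)
  case 0
  then have "Q = 0" by (intro mat_poly_eqI) (simp add: degree_below_def)
  then show ?case using zero by simp
next
  case (Suc n)
  let ?A = "mat_poly_coeff Q n"
  have "S (Q - mat_poly_const ?A ** P n)"
    by (rule Suc.IH) (use Suc.prems in \<open>auto intro: degree_below_monic_remainder\<close>)
  then have "S (mat_poly_const ?A ** P n + (Q - mat_poly_const ?A ** P n))"
    by (intro Suc.prems(3)) auto
  then show ?case by simp
qed

definition mat_monom :: "nat \<Rightarrow> complex poly^'n^'n" where
  "mat_monom n = mat (monom 1 n)"

lemma monic_mat_monom: "monic_of_degree n (mat_monom n)"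
  by (simp add: monic_of_degree_def mat_monom_def mat_poly_coeff_def vec_eq_iff mat_def)

lemma monic_minus_lower:
  "monic_of_degree n P \<Longrightarrow> degree_below n R \<Longrightarrow> monic_of_degree n (P - R)"
  by (simp add: monic_of_degree_def degree_below_def)

lemma monic_diff_degree_below:
  "monic_of_degree n P \<Longrightarrow> monic_of_degree n Q \<Longrightarrow> degree_below n (P - Q)"
  unfolding degree_below_def monic_of_degree_def
  by (metis diff_self le_neq_implies_less mat_poly_coeff_simps(2))

lemma monic_degree_below: "monic_of_degree n P \<Longrightarrow> n < m \<Longrightarrow> degree_below m P"
  by (simp add: degree_below_def monic_of_degree_def)

section \<open>Orthogonalisation for definite matrix-valued forms\<close>

lemma conj_transpose_simps:
  fixes A B :: "complex^'n^'n"
  shows "conj_transpose (A + B) = conj_transpose A + conj_transpose B"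
    "conj_transpose (A ** B) = conj_transpose B ** conj_transpose A"
    "conj_transpose 0 = (0 :: complex^'n^'n)"
    "conj_transpose (conj_transpose A) = A"
  by (simp_all add: conj_transpose_def vec_eq_iff matrix_matrix_mult_def mult.commute)

text \<open>An abstraction of \<open>\<langle>\<cdot>,\<cdot>\<rangle>\<^sub>W\<close>. The single condition \<open>definite\<close> carries the whole orthogonalisation: the
  values of \<open>form\<close> are matrices, and the invertibility of \<open>form P P\<close> that the Gram-Schmidt step
  divides by follows from it, since \<open>P\<close> may be replaced by \<open>A P\<close> for any constant matrix \<open>A\<close>.\<close>

locale definite_matrix_form =
  fixes form :: "complex poly^'n^'n \<Rightarrow> complex poly^'n^'n \<Rightarrow> complex^'n^'n"
  assumes add_left: "form (P + Q) R = form P R + form Q R"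
    and const_mult_left: "form (mat_poly_const A ** P) Q = A ** form P Q"
    and hermitian: "form Q P = conj_transpose (form P Q)"
    and definite: "form P P = 0 \<Longrightarrow> P = 0"
begin

lemma form_zero [simp]: "form 0 P = 0" "form P 0 = 0"
proof -
  show *: "form 0 P = 0" for P using add_left[of 0 0 P] by simp
  show "form P 0 = 0" using hermitian[of P 0] * by (simp add: conj_transpose_simps)
qed

lemma diff_left: "form (P - Q) R = form P R - form Q R"
  using add_left[of "P - Q" Q R] by simp

lemma add_right: "form R (P + Q) = form R P + form R Q"
  by (metis hermitian add_left conj_transpose_simps(1))

lemma const_mult_right: "form P (mat_poly_const A ** Q) = form P Q ** conj_transpose A"
  by (metis hermitian const_mult_left conj_transpose_simps(2))

lemma orthogonal_commute: "form P Q = 0 \<Longrightarrow> form Q P = 0"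
  by (metis hermitian conj_transpose_simps(3))

text \<open>A row vector \<open>x\<close> annihilating \<open>form P P\<close> from the left, repeated as the rows of a matrix \<open>A\<close>,
  makes \<open>form (A P) (A P)\<close> vanish; so \<open>A P = 0\<close>, and its leading coefficient is \<open>A\<close>.\<close>

lemma monic_norm_invertible:
  assumes "monic_of_degree n P"
  shows "\<exists>G. G ** form P P = mat 1"
proof -
  let ?G = "form P P"
  have null: "x = 0" if "transpose ?G *v x = 0" for x
  proof -
    define A :: "complex^'n^'n" where "A = (\<chi> i. x)"
    have "A ** ?G = 0"
      using that by (simp add: A_def vec_eq_iff matrix_matrix_mult_def matrix_vector_mult_def
          transpose_def mult.commute)
    then have "form (mat_poly_const A ** P) (mat_poly_const A ** P) = 0"
      by (simp add: const_mult_left const_mult_right matrix_mul_assoc)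
    then have "mat_poly_const A ** P = 0" by (rule definite)
    then have "A ** mat_poly_coeff P n = 0"
      by (metis mat_poly_coeff_const_mult mat_poly_coeff_simps(3))
    then have "A = 0" using assms by (simp add: monic_of_degree_def)
    then show ?thesis by (simp add: A_def vec_eq_iff)
  qed
  then obtain H where "H ** transpose ?G = mat 1"
    using matrix_left_invertible_ker by blast
  then have "?G ** transpose H = mat 1"
    by (metis matrix_transpose_mul transpose_mat transpose_transpose)
  then show ?thesis using matrix_left_right_inverse by blast
qed

text \<open>Gram-Schmidt in a form that needs no sequence: from \<open>n\<close> to \<open>n + 1\<close>, the projection of
  \<open>x^n\<close> itself supplies the monic \<open>P\<close> of degree \<open>n\<close> orthogonal to all lower degrees, and a
  multiple of \<open>P\<close> corrects the projection of \<open>F\<close>.\<close>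

lemma orthogonal_projection:
  "\<exists>R. degree_below n R \<and> (\<forall>Q. degree_below n Q \<longrightarrow> form (F - R) Q = 0)"
proof (induction n arbitrary: F)
  case 0
  have "Q = 0" if "degree_below 0 Q" for Q
    using that by (intro mat_poly_eqI) (simp add: degree_below_def)
  then show ?case by (metis form_zero(2) degree_below_def mat_poly_coeff_simps(3))
next
  case (Suc n)
  obtain S where S: "degree_below n S" "\<And>Q. degree_below n Q \<Longrightarrow> form (mat_monom n - S) Q = 0"
    using Suc by metis
  define P where "P = mat_monom n - S"
  have P: "monic_of_degree n P" unfolding P_def by (intro monic_minus_lower monic_mat_monom S)
  obtain R where R: "degree_below n R" "\<And>Q. degree_below n Q \<Longrightarrow> form (F - R) Q = 0"
    using Suc by metis
  obtain G where G: "G ** form P P = mat 1" using monic_norm_invertible[OF P] by blast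
  define C where "C = form (F - R) P ** G"
  define R' where "R' = R + mat_poly_const C ** P"
  have split: "form (F - R') Q = form (F - R) Q - C ** form P Q" for Q
    by (simp add: R'_def diff_diff_eq[symmetric] diff_left const_mult_left)
  have "C ** form P P = form (F - R) P"
    by (simp add: C_def matrix_mul_assoc[symmetric] G)
  then have top: "form (F - R') P = 0" by (simp add: split)
  have low: "form (F - R') Q = 0" if "degree_below n Q" for Q
    using that S(2) R(2) by (simp add: split P_def)
  have "form (F - R') Q = 0" if "degree_below (Suc n) Q" for Q
  proof -
    let ?A = "mat_poly_coeff Q n"
    have "form (F - R') (mat_poly_const ?A ** P + (Q - mat_poly_const ?A ** P)) = 0"
      by (subst add_right) (simp add: const_mult_right top low degree_below_monic_remainder[OF P that])
    then show ?thesis by simp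
  qed
  moreover have "degree_below (Suc n) R'"
    using R(1) P by (simp add: R'_def degree_below_def monic_of_degree_def)
  ultimately show ?case by blast
qed

definition orthogonal_monic :: "(nat \<Rightarrow> complex poly^'n^'n) \<Rightarrow> bool" where
  "orthogonal_monic P \<longleftrightarrow>
     (\<forall>n. monic_of_degree n (P n)) \<and> (\<forall>n m. n \<noteq> m \<longrightarrow> form (P n) (P m) = 0)"

lemma orthogonal_to_lower:
  assumes "orthogonal_monic P" "degree_below n Q"
  shows "form (P n) Q = 0"
proof -
  have "monic_of_degree k (P k)" for k using assms(1) by (simp add: orthogonal_monic_def)
  from this assms(2) show ?thesis
    by (induction rule: monic_sequence_induct)
      (use assms(1) in \<open>auto simp: orthogonal_monic_def add_right const_mult_right\<close>)
qed

text \<open>Two orthogonal monic polynomials of degree \<open>n\<close> differ by a polynomial of lower degree, to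
  which both, and hence also their difference, are orthogonal.\<close>

theorem ex1_orthogonal_monic: "\<exists>!P. orthogonal_monic P"
proof (rule ex_ex1I)
  obtain R where R: "\<And>n. degree_below n (R n)"
    "\<And>n Q. degree_below n Q \<Longrightarrow> form (mat_monom n - R n) Q = 0"
  proof -
    have "\<forall>n. \<exists>R. degree_below n R \<and>
        (\<forall>Q. degree_below n Q \<longrightarrow> form (mat_monom n - R) Q = 0)"
      using orthogonal_projection by blast
    then show thesis using that by metis
  qed
  define P where "P n = mat_monom n - R n" for n
  have monic: "monic_of_degree n (P n)" for n
    unfolding P_def by (intro monic_minus_lower monic_mat_monom R)
  have "form (P n) (P m) = 0" if "m < n" for m n
    using R(2) monic_degree_below[OF monic that] by (simp add: P_def)
  then have "form (P n) (P m) = 0" if "n \<noteq> m" for m n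
    using that orthogonal_commute by (metis nat_neq_iff)
  then show "\<exists>P. orthogonal_monic P"
    using monic by (auto simp: orthogonal_monic_def)
next
  fix P Q
  assume PQ: "orthogonal_monic P" "orthogonal_monic Q"
  show "P = Q"
  proof
    fix n
    have low: "degree_below n (P n - Q n)"
      using PQ by (intro monic_diff_degree_below) (auto simp: orthogonal_monic_def)
    have "form (P n - Q n) (P n - Q n) = 0"
      using PQ[THEN orthogonal_to_lower, OF low] by (simp add: diff_left)
    then show "P n = Q n" using definite by fastforce
  qed
qed

end

section \<open>The inner product of a weight matrix\<close>

lemma mat_poly_eval_expand:
  assumes "degree_below N P"
  shows "mat_poly_eval P (of_real x) = (\<Sum>k<N. x ^ k *\<^sub>R mat_poly_coeff P k)"
proof -
  have "poly (P $ i $ j) (of_real x) = (\<Sum>k<N. x ^ k *\<^sub>R coeff (P $ i $ j) k)" for i j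
  proof -
    have z: "coeff (P $ i $ j) k = 0" if "k \<ge> N" for k
      using assms that by (simp add: degree_below_def mat_poly_coeff_def vec_eq_iff)
    have "poly (P $ i $ j) (of_real x) =
        (\<Sum>k\<le>degree (P $ i $ j). coeff (P $ i $ j) k * of_real x ^ k)"
      by (rule poly_altdef)
    also have "\<dots> = (\<Sum>k\<in>{..degree (P $ i $ j)} \<union> {..<N}. coeff (P $ i $ j) k * of_real x ^ k)"
      by (rule sum.mono_neutral_left) (auto simp: coeff_eq_0)
    also have "\<dots> = (\<Sum>k<N. coeff (P $ i $ j) k * of_real x ^ k)"
      by (rule sum.mono_neutral_right) (auto simp: z)
    finally show ?thesis by (simp add: scaleR_conv_of_real mult.commute)
  qed
  then show ?thesis by (simp add: mat_poly_eval_def mat_poly_coeff_def vec_eq_iff)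
qed

lemma bounded_linear_sandwich: "bounded_linear (\<lambda>A. B ** A ** (C :: complex^'n^'n))"
  unfolding linear_conv_bounded_linear[symmetric]
  by (rule linearI)
    (simp_all add: vec_eq_iff matrix_matrix_mult_def sum.distrib algebra_simps scaleR_sum_right
      sum_distrib_left)

lemma bounded_linear_conj_transpose: "bounded_linear (conj_transpose :: complex^'n^'n \<Rightarrow> _)"
  unfolding linear_conv_bounded_linear[symmetric]
  by (rule linearI) (simp_all add: vec_eq_iff conj_transpose_def)

definition weight_integrand ::
    "(real \<Rightarrow> complex^'n^'n) \<Rightarrow> complex poly^'n^'n \<Rightarrow> complex poly^'n^'n \<Rightarrow> real \<Rightarrow> complex^'n^'n" where
  "weight_integrand W P Q x =
     mat_poly_eval P (of_real x) ** W x ** conj_transpose (mat_poly_eval Q (of_real x))"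

text \<open>Writing the integrand as a sum of moments \<open>x^m W(x)\<close> under fixed linear maps
  \<open>A \<mapsto> B A C\<close> reduces its integrability to the finiteness of the moments.\<close>

lemma weight_integrand_expand:
  fixes P Q :: "complex poly^'n^'n"
  assumes "degree_below N P" "degree_below M Q"
  shows "weight_integrand W P Q x = (\<Sum>k<N. \<Sum>l<M.
    mat_poly_coeff P k ** (x ^ (k + l) *\<^sub>R W x) ** conj_transpose (mat_poly_coeff Q l))"
proof -
  interpret ct: bounded_linear "conj_transpose :: complex^'n^'n \<Rightarrow> _"
    by (rule bounded_linear_conj_transpose)
  have l: "sum f S ** A = (\<Sum>k\<in>S. f k ** A)" for f :: "nat \<Rightarrow> complex^'n^'n" and S A
    by (induction S rule: infinite_finite_induct) (simp_all add: matrix_mult_rdistrib)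
  have r: "A ** sum f S = (\<Sum>k\<in>S. A ** f k)" for f :: "nat \<Rightarrow> complex^'n^'n" and S A
    by (induction S rule: infinite_finite_induct) (simp_all add: matrix_add_ldistrib)
  have s: "(a *\<^sub>R A) ** B = a *\<^sub>R (A ** B)" "A ** (a *\<^sub>R B) = a *\<^sub>R (A ** B)"
    for a and A B :: "complex^'n^'n"
    by (simp_all add: vec_eq_iff matrix_matrix_mult_def scaleR_sum_right)
  show ?thesis
    by (simp add: weight_integrand_def mat_poly_eval_expand[OF assms(1)]
        mat_poly_eval_expand[OF assms(2)] ct.sum ct.scaleR l r s scaleR_sum_right power_add)
      (simp add: mult.commute sum.swap[of _ "{..<M}"])
qed

lemma weight_integrand_integrable:
  assumes "finite_moments x0 x1 W"
  shows "set_integrable lborel (einterval x0 x1) (weight_integrand W P Q)"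
proof -
  obtain N M where *: "degree_below N P" "degree_below M Q" using degree_below_exists by metis
  have "set_integrable lborel (einterval x0 x1) (\<lambda>x. \<Sum>k<N. \<Sum>l<M.
    mat_poly_coeff P k ** (x ^ (k + l) *\<^sub>R W x) ** conj_transpose (mat_poly_coeff Q l))"
    unfolding set_integrable_def scaleR_sum_right
  proof (intro Bochner_Integration.integrable_sum)
    fix k l
    have "set_integrable lborel (einterval x0 x1) (\<lambda>x. x ^ (k + l) *\<^sub>R W x)"
      using assms by (simp add: finite_moments_def)
    from integrable_bounded_linear[OF bounded_linear_sandwich this[unfolded set_integrable_def]]
    show "integrable lborel (\<lambda>x. indicator (einterval x0 x1) x *\<^sub>R
      (mat_poly_coeff P k ** (x ^ (k + l) *\<^sub>R W x) ** conj_transpose (mat_poly_coeff Q l)))"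
      by (simp only: linear_simps(5)[OF bounded_linear_sandwich])
  qed
  then show ?thesis by (simp add: weight_integrand_expand[OF *, abs_def])
qed

text \<open>The diagonal entry is the quadratic form of \<open>W x\<close> at the conjugate of the \<open>i\<close>-th row of
  \<open>P\<close>.\<close>

lemma weight_integrand_diagonal_pos:
  assumes "pos_definite (W x)" "poly (P $ i $ j) (of_real x) \<noteq> 0"
  shows "Re (weight_integrand W P P x $ i $ i) > 0"
proof -
  define v where "v = (\<chi> k. cnj (poly (P $ i $ k) (of_real x)))"
  have "v \<noteq> 0" using assms(2) by (auto simp: v_def vec_eq_iff)
  then have "Re (\<Sum>k\<in>UNIV. \<Sum>l\<in>UNIV. cnj (v $ k) * W x $ k $ l * v $ l) > 0"
    using assms(1) by (simp add: pos_definite_def)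
  also have "(\<Sum>k\<in>UNIV. \<Sum>l\<in>UNIV. cnj (v $ k) * W x $ k $ l * v $ l) =
      weight_integrand W P P x $ i $ i"
    by (subst sum.swap) (simp add: weight_integrand_def v_def mat_poly_eval_def conj_transpose_def
        matrix_matrix_mult_def sum_distrib_right)
  finally show ?thesis .
qed

lemma AE_poly_of_real_nonzero:
  assumes "(p :: complex poly) \<noteq> 0"
  shows "AE x in lborel. poly p (of_real x) \<noteq> 0"
proof (rule AE_I')
  have "finite ((of_real :: real \<Rightarrow> complex) -` {z. poly p z = 0})"
    by (intro finite_vimageI poly_roots_finite assms inj_of_real)
  then show "{x. poly p (of_real x :: complex) = 0} \<in> null_sets lborel"
    by (intro countable_imp_null_set_lborel countable_finite) (simp add: vimage_def)
qed auto

lemma not_AE_notin_einterval: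
  assumes "x0 < x1"
  shows "\<not> (AE x in lborel. x \<notin> einterval x0 x1)"
proof
  assume "AE x in lborel. x \<notin> einterval x0 x1"
  then have "einterval x0 x1 \<in> null_sets lborel"
    by (subst (asm) AE_iff_null_sets[symmetric]) auto
  then have "negligible (einterval x0 x1)"
    by (simp add: negligible_iff_null_sets null_sets_completionI)
  moreover have "einterval x0 x1 \<noteq> {}"
    using ereal_dense2[OF assms] by (auto simp: einterval_def)
  ultimately show False using open_not_negligible open_einterval by blast
qed

proposition weight_inner_definite:
  fixes W :: "real \<Rightarrow> complex^'n^'n"
  assumes "weight_matrix x0 x1 W"
  shows "definite_matrix_form (weight_inner x0 x1 W)"
proof -
  let ?I = "einterval x0 x1"
  have less: "x0 < x1" and mom: "finite_moments x0 x1 W"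
    and pos: "AE x in lborel. x \<in> ?I \<longrightarrow> pos_definite (W x)"
    using assms by (auto simp: weight_matrix_def)
  have inner: "weight_inner x0 x1 W P Q =
      (\<integral>x. indicator ?I x *\<^sub>R weight_integrand W P Q x \<partial>lborel)" for P Q
    using less by (simp add: weight_inner_def weight_integrand_def[abs_def]
        interval_lebesgue_integral_def set_lebesgue_integral_def)
  have int: "integrable lborel (\<lambda>x. indicator ?I x *\<^sub>R weight_integrand W P Q x)" for P Q
    using weight_integrand_integrable[OF mom] by (simp add: set_integrable_def)
  show ?thesis
  proof
    fix P Q R :: "complex poly^'n^'n"
    have "weight_integrand W (P + Q) R x = weight_integrand W P R x + weight_integrand W Q R x" for x
    proof -
      have "mat_poly_eval (P + Q) (of_real x) =
          mat_poly_eval P (of_real x) + mat_poly_eval Q (of_real x)"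
        by (simp add: mat_poly_eval_def vec_eq_iff)
      then show ?thesis by (simp add: weight_integrand_def matrix_mult_rdistrib)
    qed
    then show "weight_inner x0 x1 W (P + Q) R = weight_inner x0 x1 W P R + weight_inner x0 x1 W Q R"
      by (simp add: inner scaleR_add_right int)
  next
    fix A :: "complex^'n^'n" and P Q :: "complex poly^'n^'n"
    interpret mult: bounded_linear "\<lambda>B. A ** B"
      using bounded_linear_sandwich[of A "mat 1"] by simp
    have "weight_integrand W (mat_poly_const A ** P) Q x = A ** weight_integrand W P Q x" for x
    proof -
      have "mat_poly_eval (mat_poly_const A ** P) (of_real x) = A ** mat_poly_eval P (of_real x)"
        by (simp add: mat_poly_eval_def mat_poly_const_def vec_eq_iff matrix_matrix_mult_def poly_sum)
      then show ?thesis by (simp add: weight_integrand_def matrix_mul_assoc)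
    qed
    then show "weight_inner x0 x1 W (mat_poly_const A ** P) Q = A ** weight_inner x0 x1 W P Q"
      using integral_bounded_linear[OF mult.bounded_linear_axioms int[of P Q]]
      by (simp add: inner mult.scaleR)
  next
    fix P Q :: "complex poly^'n^'n"
    interpret ct: bounded_linear "conj_transpose :: complex^'n^'n \<Rightarrow> _"
      by (rule bounded_linear_conj_transpose)
    have "AE x in lborel. indicator ?I x *\<^sub>R weight_integrand W Q P x =
        conj_transpose (indicator ?I x *\<^sub>R weight_integrand W P Q x)"
      using pos
    proof eventually_elim
      case (elim x)
      then show ?case
        by (cases "x \<in> ?I")
          (simp_all add: weight_integrand_def conj_transpose_simps matrix_mul_assoc pos_definite_def)
    qed
    then have "weight_inner x0 x1 W Q P =
        (\<integral>x. conj_transpose (indicator ?I x *\<^sub>R weight_integrand W P Q x) \<partial>lborel)"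
      unfolding inner
      by (intro integral_cong_AE borel_measurable_integrable int
          integrable_bounded_linear[OF bounded_linear_conj_transpose])
    also have "\<dots> = conj_transpose (weight_inner x0 x1 W P Q)"
      unfolding inner by (rule integral_bounded_linear[OF bounded_linear_conj_transpose int])
    finally show "weight_inner x0 x1 W Q P = conj_transpose (weight_inner x0 x1 W P Q)" .
  next
    fix P :: "complex poly^'n^'n"
    assume zero: "weight_inner x0 x1 W P P = 0"
    show "P = 0"
    proof (rule ccontr)
      assume "P \<noteq> 0"
      then obtain i j where nz: "P $ i $ j \<noteq> 0" by (auto simp: vec_eq_iff)
      \<comment> \<open>This entry is almost everywhere positive on the interval, yet its integral vanishes, so
        the interval would be a null set.\<close>
      define g where "g x = Re ((indicator ?I x *\<^sub>R weight_integrand W P P x) $ i $ i)" for x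
      have bl: "bounded_linear (\<lambda>A :: complex^'n^'n. Re (A $ i $ i))"
        unfolding linear_conv_bounded_linear[symmetric] by (rule linearI) simp_all
      have g: "g x > 0" if "x \<in> ?I" "pos_definite (W x)" "poly (P $ i $ j) (of_real x) \<noteq> 0" for x
        using weight_integrand_diagonal_pos[of W x P i j] that(2,3) that(1) by (simp add: g_def)
      have "AE x in lborel. 0 \<le> g x \<and> (x \<in> ?I \<longrightarrow> 0 < g x)"
        using pos AE_poly_of_real_nonzero[OF nz]
      proof eventually_elim
        case (elim x)
        then show ?case using g[of x] by (cases "x \<in> ?I") (auto simp: g_def)
      qed
      then have nonneg: "AE x in lborel. 0 \<le> g x" and gpos: "AE x in lborel. x \<in> ?I \<longrightarrow> 0 < g x"
        by auto
      have gint: "integrable lborel g"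
        unfolding g_def by (rule integrable_bounded_linear[OF bl int])
      have "integral\<^sup>L lborel g = Re (weight_inner x0 x1 W P P $ i $ i)"
        unfolding g_def inner by (rule integral_bounded_linear[OF bl int])
      then have "AE x in lborel. g x = 0"
        using integral_nonneg_eq_0_iff_AE[OF gint nonneg] by (simp add: zero)
      with gpos have "AE x in lborel. x \<notin> ?I"
        by eventually_elim auto
      then show False using not_AE_notin_einterval[OF less] by blast
    qed
  qed
qed

lemma monic_of_degree_monic_OP:
  assumes "weight_matrix x0 x1 W"
  shows "monic_of_degree n (monic_OP x0 x1 W n)"
proof -
  interpret definite_matrix_form "weight_inner x0 x1 W"
    by (rule weight_inner_definite[OF assms])
  have "is_monic_orthogonal x0 x1 W = orthogonal_monic"
    by (simp add: fun_eq_iff is_monic_orthogonal_def orthogonal_monic_def)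
  then have "orthogonal_monic (monic_OP x0 x1 W)"
    unfolding monic_OP_def using theI'[OF ex1_orthogonal_monic] by simp
  then show ?thesis by (simp add: orthogonal_monic_def)
qed

section \<open>Eigenvalues as matrix polynomials\<close>

lemma diffop_act_const_mult: "(mat_poly_const A ** P) \<cdot>\<^sub>D D = mat_poly_const A ** (P \<cdot>\<^sub>D D)"
proof -
  have "mat_pderiv (mat_poly_const A ** P) = mat_poly_const A ** mat_pderiv P" for P
  proof -
    have "mat_pderiv (mat_poly_const A) = 0"
      by (simp add: mat_pderiv_def mat_poly_const_def vec_eq_iff pderiv_pCons)
    then show ?thesis by (simp add: mat_pderiv_mult)
  qed
  then have "(mat_pderiv ^^ j) (mat_poly_const A ** P) = mat_poly_const A ** (mat_pderiv ^^ j) P" for j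
    by (induction j) simp_all
  then show ?thesis by (simp add: diffop_act_def mat_mult_sum matrix_mul_assoc)
qed

lemma diffop_act_one: "P \<cdot>\<^sub>D 1 = P"
  by (simp add: one_diffop_def diffop_act_single)

lemma diffop_act_scale: "P \<cdot>\<^sub>D diffop_scale c D = mat_scale [:c:] (P \<cdot>\<^sub>D D)"
proof -
  have scale_sum: "mat_scale a (sum f S) = (\<Sum>j\<in>S. mat_scale a (f j))"
    for a and f :: "nat \<Rightarrow> complex poly^'a^'a" and S
    by (simp add: mat_scale_def vec_eq_iff sum_distrib_left)
  have "diffop_supp (diffop_scale c D) \<subseteq> diffop_supp D"
    by (auto simp: diffop_supp_def diffop_coeff_scale mat_scale_def vec_eq_iff)
  then show ?thesis
    by (simp add: diffop_act_superset[where S="diffop_supp D"] diffop_coeff_scale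
        mat_scale_mult scale_sum)
qed

text \<open>For \<open>i > n\<close> the product contains the factor \<open>n - n\<close>, so that the truncated exponent does no
  harm.\<close>

lemma higher_pderiv_monom:
  "(pderiv ^^ i) (monom (1 :: complex) n) = monom (\<Prod>j<i. of_nat n - of_nat j) (n - i)"
proof (induction i)
  case (Suc i)
  have "of_nat (n - i) * (\<Prod>j<i. of_nat n - of_nat j) =
      (of_nat n - of_nat i) * (\<Prod>j<i. of_nat n - of_nat j :: complex)"
  proof (cases "i \<le> n")
    case False
    then have "(\<Prod>j<i. of_nat n - of_nat j :: complex) = 0" by auto
    then show ?thesis by simp
  qed (simp add: of_nat_diff)
  then show ?case by (simp add: Suc pderiv_monom mult.commute)
qed simp

text \<open>The sum over \<open>i\<close> of the falling factorials of degree \<open>i\<close> in the variable \<open>n\<close> times the matrix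
  coefficient of \<open>x^i\<close> in \<open>F\<^sub>i\<close>.\<close>

definition eigenvalue_poly :: "'n::finite diffop \<Rightarrow> complex poly^'n^'n" where
  "eigenvalue_poly D = (\<chi> a b. \<Sum>i\<in>diffop_supp D.
     [:coeff (diffop_coeff D i $ a $ b) i:] * (\<Prod>j<i. [:- of_nat j, 1:]))"

text \<open>In \<open>n(n-1)\<dots>(n-i+1) x^(n-i) F\<^sub>i\<close> the coefficient of \<open>x^n\<close> involves only the \<open>i\<close>-th
  coefficient of \<open>F\<^sub>i\<close>.\<close>

lemma coeff_mat_monom_act:
  "mat_poly_coeff (mat_monom n \<cdot>\<^sub>D D) n = mat_poly_eval (eigenvalue_poly D) (of_nat n)"
proof -
  have "mat_poly_coeff ((mat_pderiv ^^ i) (mat_monom n) ** F) n $ a $ b =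
      coeff (F $ a $ b) i * (\<Prod>j<i. of_nat n - of_nat j)" for i F and a b :: 'a
  proof -
    let ?c = "\<Prod>j<i. of_nat n - of_nat j :: complex"
    have d: "(mat_pderiv ^^ i) (mat_monom n) = mat (monom ?c (n - i))"
      by (simp add: mat_pderiv_power_coeff mat_monom_def mat_def vec_eq_iff higher_pderiv_monom
          higher_pderiv_0)
    have "mat p ** F = mat_scale p F" for p
      by (simp add: mat_def matrix_matrix_mult_def mat_scale_def vec_eq_iff if_distrib
          if_distribR cong: if_cong)
    then have "mat_poly_coeff ((mat_pderiv ^^ i) (mat_monom n) ** F) n $ a $ b =
        coeff (monom ?c (n - i) * F $ a $ b) n"
      by (simp add: d mat_poly_coeff_def mat_scale_def)
    also have "\<dots> = coeff (F $ a $ b) i * ?c"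
    proof (cases "i \<le> n")
      case False
      then have c: "?c = 0" by auto
      show ?thesis by (simp only: c) simp
    qed (simp add: coeff_monom_mult)
    finally show ?thesis .
  qed
  then show ?thesis
    by (simp add: diffop_act_def mat_poly_coeff_sum vec_eq_iff mat_poly_eval_def
        eigenvalue_poly_def poly_sum poly_prod)
qed

text \<open>The difference \<open>P n - x^n\<close> is a left combination of lower \<open>P k\<close>, each of which \<open>D\<close> maps to a
  multiple of itself; so it contributes nothing to the coefficient of \<open>x^n\<close> in the image of
  \<open>P n\<close>.\<close>

lemma leading_eigenvalue:
  assumes monic: "\<And>n. monic_of_degree n (P n)"
    and eigen: "\<And>n. \<exists>A. P n \<cdot>\<^sub>D D = mat_poly_const A ** P n"
    and A: "P n \<cdot>\<^sub>D D = mat_poly_const A ** P n"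
  shows "A = mat_poly_eval (eigenvalue_poly D) (of_nat n)"
proof -
  have "degree_below n (P n - mat_monom n)"
    by (intro monic_diff_degree_below monic monic_mat_monom)
  with monic have "degree_below n ((P n - mat_monom n) \<cdot>\<^sub>D D)"
  proof (induction rule: monic_sequence_induct)
    case zero
    have "(0 :: complex poly^'a^'a) \<cdot>\<^sub>D D = 0" by (simp add: diffop_act_def)
    then show ?case by (simp add: degree_below_def)
  next
    case (step k B R)
    obtain C where "P k \<cdot>\<^sub>D D = mat_poly_const C ** P k" using eigen by blast
    then show ?case
      using step monic[of k]
      by (simp add: diffop_act_add_left diffop_act_const_mult degree_below_def monic_of_degree_def)
  qed
  moreover have "P n \<cdot>\<^sub>D D = (P n - mat_monom n) \<cdot>\<^sub>D D + mat_monom n \<cdot>\<^sub>D D"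
    by (simp add: diffop_act_add_left[symmetric])
  ultimately have "mat_poly_coeff (P n \<cdot>\<^sub>D D) n = mat_poly_coeff (mat_monom n \<cdot>\<^sub>D D) n"
    by (simp add: degree_below_def)
  then show ?thesis
    using monic[of n] by (simp add: A coeff_mat_monom_act monic_of_degree_def)
qed

lemma diffop_eq_on_monic_sequence:
  assumes monic: "\<And>n. monic_of_degree n (P n)" and eq: "\<And>n. P n \<cdot>\<^sub>D D = P n \<cdot>\<^sub>D E"
  shows "D = E"
proof (rule diffop_act_inject)
  fix Q :: "complex poly^'a^'a"
  obtain n where "degree_below n Q" using degree_below_exists by blast
  with monic show "Q \<cdot>\<^sub>D D = Q \<cdot>\<^sub>D E"
  proof (induction rule: monic_sequence_induct)
    case zero
    show ?case by (simp add: diffop_act_def)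
  next
    case (step k A R)
    then show ?case by (simp add: diffop_act_add_left diffop_act_const_mult eq)
  qed
qed

lemma mat_poly_eval_simps:
  "mat_poly_eval (P + Q) z = mat_poly_eval P z + mat_poly_eval Q z"
  "mat_poly_eval (P ** Q) z = mat_poly_eval P z ** mat_poly_eval Q z"
  "mat_poly_eval (mat 1) z = mat 1"
  "mat_poly_eval (mat_scale [:c:] P) z = mat_scale c (mat_poly_eval P z)"
  by (simp_all add: mat_poly_eval_def vec_eq_iff matrix_matrix_mult_def poly_sum mat_def mat_scale_def)

lemma mat_poly_eq_on_nats:
  assumes "\<And>n :: nat. mat_poly_eval P (of_nat n) = mat_poly_eval Q (of_nat n)"
  shows "P = Q"
proof -
  have "P $ i $ j = Q $ i $ j" for i j
  proof (rule ccontr)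
    assume "P $ i $ j \<noteq> Q $ i $ j"
    then have "finite {z. poly (P $ i $ j - Q $ i $ j) z = 0}"
      by (intro poly_roots_finite) simp
    moreover have "range of_nat \<subseteq> {z. poly (P $ i $ j - Q $ i $ j) z = 0}"
      using assms by (auto simp: mat_poly_eval_def vec_eq_iff)
    ultimately have "finite (range (of_nat :: nat \<Rightarrow> complex))"
      using finite_subset by blast
    then show False by (simp add: finite_image_iff inj_of_nat)
  qed
  then show ?thesis by (simp add: vec_eq_iff)
qed

section \<open>The eigenvalue map\<close>

theorem proposition5p1:
  fixes x0 x1 :: ereal and W :: "real \<Rightarrow> complex^'n^'n"
  assumes "weight_matrix x0 x1 W"
  shows "is_subalgebra (weight_diffops x0 x1 W)
    \<and> (\<forall>D\<in>weight_diffops x0 x1 W. \<forall>n. mat_poly_eval (Lambda x0 x1 W D) (of_nat n) = eigenvalue x0 x1 W D n)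
    \<and> is_algebra_hom_on (weight_diffops x0 x1 W) (Lambda x0 x1 W)
    \<and> inj_on (Lambda x0 x1 W) (weight_diffops x0 x1 W)"
proof -
  let ?D = "weight_diffops x0 x1 W"
  let ?L = "Lambda x0 x1 W"
  let ?ev = "\<lambda>D n. mat_poly_eval (?L D) (of_nat n)"
  define P where "P = monic_OP x0 x1 W"
  have monic: "monic_of_degree n (P n)" for n
    unfolding P_def by (rule monic_of_degree_monic_OP[OF assms])
  have mem: "D \<in> ?D \<longleftrightarrow> (\<forall>n. \<exists>A. P n \<cdot>\<^sub>D D = mat_poly_const A ** P n)" for D
    by (simp add: weight_diffops_def P_def)
  have memI: "D \<in> ?D" if "\<And>n. P n \<cdot>\<^sub>D D = mat_poly_const (A n) ** P n" for D A
    using that mem by blast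
  have eigenvalue: "eigenvalue x0 x1 W D n = A"
    if "P n \<cdot>\<^sub>D D = mat_poly_const A ** P n" for D n A
    unfolding eigenvalue_def P_def[symmetric]
  proof (rule the_equality)
    show "P n \<cdot>\<^sub>D D = mat_poly_const A ** P n" by (rule that)
    fix B assume "P n \<cdot>\<^sub>D D = mat_poly_const B ** P n"
    then have "mat_poly_coeff (mat_poly_const B ** P n) n = mat_poly_coeff (mat_poly_const A ** P n) n"
      using that by simp
    then show "B = A" using monic[of n] by (simp add: monic_of_degree_def)
  qed
  have eval: "?ev D n = eigenvalue x0 x1 W D n" if "D \<in> ?D" for D n
  proof -
    have ex: "\<exists>A. P n \<cdot>\<^sub>D D = mat_poly_const A ** P n" for n
      using that mem by blast
    then have *: "\<forall>n. mat_poly_eval (eigenvalue_poly D) (of_nat n) = eigenvalue x0 x1 W D n"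
      using eigenvalue leading_eigenvalue[OF monic ex] by metis
    have "?L D = eigenvalue_poly D"
      unfolding Lambda_def
      by (rule the_equality[where P="\<lambda>L. \<forall>n. mat_poly_eval L (of_nat n) = eigenvalue x0 x1 W D n", OF *])
        (rule mat_poly_eq_on_nats, simp add: *)
    with * show ?thesis by simp
  qed
  have act: "P n \<cdot>\<^sub>D D = mat_poly_const (?ev D n) ** P n" if "D \<in> ?D" for D n
    using that mem eigenvalue eval by metis
  \<comment> \<open>With \<open>memI\<close> this derives membership in the algebra and the value of \<open>\<Lambda>\<close> from one and the same
    eigenvalue equation, which has to be found only once for each algebraic operation.\<close>
  have Lambda_eqI: "?L D = L"
    if "\<And>n. P n \<cdot>\<^sub>D D = mat_poly_const (mat_poly_eval L (of_nat n)) ** P n" for D L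
    using that eval[OF memI[OF that]] eigenvalue[OF that] by (intro mat_poly_eq_on_nats) simp
  have one: "P n \<cdot>\<^sub>D 1 = mat_poly_const (mat_poly_eval (mat 1) (of_nat n)) ** P n" for n
    by (simp add: diffop_act_one mat_poly_eval_simps mat_poly_const_algebra)
  have add: "P n \<cdot>\<^sub>D (D + E) = mat_poly_const (mat_poly_eval (?L D + ?L E) (of_nat n)) ** P n"
    if "D \<in> ?D" "E \<in> ?D" for D E n
    by (simp add: diffop_act_add_right act that mat_poly_eval_simps mat_poly_const_algebra)
  have times: "P n \<cdot>\<^sub>D (D * E) = mat_poly_const (mat_poly_eval (?L D ** ?L E) (of_nat n)) ** P n"
    if "D \<in> ?D" "E \<in> ?D" for D E n
    by (simp add: diffop_act_times diffop_act_const_mult act that mat_poly_eval_simps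
        mat_poly_const_algebra)
  have scale: "P n \<cdot>\<^sub>D diffop_scale c D =
      mat_poly_const (mat_poly_eval (mat_scale [:c:] (?L D)) (of_nat n)) ** P n"
    if "D \<in> ?D" for c D n
    by (simp add: diffop_act_scale act that mat_poly_eval_simps mat_poly_const_scale)
  have "is_subalgebra ?D"
    unfolding is_subalgebra_def
    using memI[OF one] memI[OF add] memI[OF times] memI[OF scale] by blast
  moreover have "is_algebra_hom_on ?D ?L"
    unfolding is_algebra_hom_on_def
    using Lambda_eqI[OF one] Lambda_eqI[OF add] Lambda_eqI[OF times] Lambda_eqI[OF scale] by blast
  moreover have "inj_on ?L ?D"
  proof (rule inj_onI)
    fix D E assume "D \<in> ?D" "E \<in> ?D" "?L D = ?L E"
    then show "D = E" by (intro diffop_eq_on_monic_sequence[OF monic]) (simp add: act)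
  qed
  ultimately show ?thesis using eval by blast
qed

end
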